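(* Let $r>0$ and let $P_{r\mathbb{B}}: l_1 \rightrightarrows r\mathbb{B}$ be the (set-valued) metric projection onto the closed ball $r\mathbb{B}$ of $l_1$. Its Mordukhovich derivatives have the following properties. (i) For every $x \in l_1$ with $\|x\|_1<r$, $$\widehat{D}^*P_{r\mathbb{B}}(x,x)(\varphi)=\{\varphi\}\quad\text{for every }\varphi\in l_\infty.$$ (ii) For every $x\in K_1^+$ with $\|x\|_1>r$: (a) $\widehat{D}^*P_{r\mathbb{B}}\left(x,\frac{r}{\|x\|_1}x\right)(\theta^* )=\{\theta^*\}$; (b) $\widehat{D}^*P_{r\mathbb{B}}\left(x,\frac{r}{\|x\|_1}x\right)(\beta_d)=\emptyset$ for any $d>0$; (c) $\widehat{D}^*P_{r\mathbb{B}}\left(x,\frac{r}{\|x\|_1}x\right)(J(x))=\emptyset$.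
   Context: $(l_1,\|\cdot\|_1)$ is the real Banach space of absolutely summable real sequences, with dual $(l_\infty,\|\cdot\|_\infty)$ and canonical pairing $\langle\varphi,x\rangle=\sum_n u_n t_n$ for $\varphi=(u_n)\in l_\infty$, $x=(t_n)\in l_1$. $\theta^*$ is the origin of $l_\infty$. $r\mathbb{B}=\{x\in l_1:\|x\|_1\le r\}$. $K_1^+=\{x=(t_1,t_2,\ldots)\in l_1: t_n>0\text{ for all }n\}$. For real $d$, $\beta_d=(d,d,d,\ldots)\in l_\infty$. The normalized duality mapping $J:l_1\to 2^{l_\infty}$ is $J(x)=\{\varphi\in l_\infty:\langle\varphi,x\rangle=\|\varphi\|_\infty\|x\|_1=\|x\|_1^2=\|\varphi\|_\infty^2\}$. For $x\in K_1^+$ the set $J(x)$ is a singleton, and it is identified with its unique element. For a nonempty closed convex subset $C$ of a Banach space $X$, the metric projection is $P_C(x)=\{u\in C:\|x-u\|\le\|x-z\|\text{ for all }z\in C\}$. For $x\in X$ and $y\in P_C(x)$, the Mordukhovich derivative of $P_C$ at $(x,y)$ is the set-valued mapping $\widehat{D}^*P_C(x,y):X^*\rightrightarrows X^*$ given by $$\widehat{D}^*P_C(x,y)(y^* )=\left\{x^*\in X^*:\limsup_{\substack{(u,v)\to(x,y)\\ v\in P_C(u)}}\frac{\langle x^*,u-x\rangle-\langle y^*,v-y\rangle}{\|u-x\|+\|v-y\|}\le 0\right\},\quad y^*\in X^*,$$ where the limsup is over pairs $(u,v)\neq(x,y)$. (For $x\in l_1$ with $\|x\|_1>r$, $\frac{r}{\|x\|_1}x\in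 P_{r\mathbb{B}}(x)$.) *)

theory Defs
  imports "HOL-Analysis.Analysis"
begin

section \<open>Metric projection, duality mapping and Mordukhovich derivative\<close>

text \<open>The dual of a real normed space \<open>'a\<close> is the space \<open>'a \<Rightarrow>\<^sub>L real\<close> of bounded linear functionals
  with the operator norm.\<close>

definition metric_projection :: "'a::banach set \<Rightarrow> 'a \<Rightarrow> 'a set" where
  "metric_projection C x = {u \<in> C. \<forall>z\<in>C. norm (x - u) \<le> norm (x - z)}"

definition duality_mapping :: "'a::banach \<Rightarrow> ('a \<Rightarrow>\<^sub>L real) set" where
  "duality_mapping x =
    {\<phi>. blinfun_apply \<phi> x = norm \<phi> * norm x \<and> norm \<phi> * norm x = (norm x)\<^sup>2 \<and> (norm x)\<^sup>2 = (norm \<phi>)\<^sup>2}"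

text \<open>The filter \<open>at (x, y) within graph\<close> excludes the base point \<open>(x, y)\<close> itself. The upper limit
  is taken in the extended reals because \<open>Limsup\<close> needs a complete lattice. The derivative is meant
  for points with \<open>y \<in> P x\<close>.\<close>

definition mordukhovich_derivative ::
  "('a::banach \<Rightarrow> 'a set) \<Rightarrow> 'a \<Rightarrow> 'a \<Rightarrow> ('a \<Rightarrow>\<^sub>L real) \<Rightarrow> ('a \<Rightarrow>\<^sub>L real) set" where
  "mordukhovich_derivative P x y y' =
    {x'. Limsup (at (x, y) within {(u, v). v \<in> P u})
           (\<lambda>(u, v). ereal ((blinfun_apply x' (u - x) - blinfun_apply y' (v - y)) /
                            (norm (u - x) + norm (v - y)))) \<le> 0}"

section \<open>The Banach space of absolutely summable real sequences\<close>

text \<open>Sequences are indexed from 0.\<close>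

typedef l1 = "{x :: nat \<Rightarrow> real. summable (\<lambda>n. \<bar>x n\<bar>)}"
  morphisms l1_nth Abs_l1
  by (intro exI[of _ "\<lambda>_. 0"]) simp

setup_lifting type_definition_l1

lemma l1_eqI: "(\<And>n. l1_nth x n = l1_nth y n) \<Longrightarrow> x = y"
  by transfer auto

lemma summable_l1_abs [simp, intro]: "summable (\<lambda>n. \<bar>l1_nth x n\<bar>)"
  by transfer simp

instantiation l1 :: real_vector
begin

lift_definition zero_l1 :: l1 is "\<lambda>_. 0" by simp

lift_definition plus_l1 :: "l1 \<Rightarrow> l1 \<Rightarrow> l1" is "\<lambda>x y n. x n + y n"
proof -
  fix x y :: "nat \<Rightarrow> real"
  assume "summable (\<lambda>n. \<bar>x n\<bar>)" and "summable (\<lambda>n. \<bar>y n\<bar>)"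
  then have "summable (\<lambda>n. \<bar>x n\<bar> + \<bar>y n\<bar>)" by (rule summable_add)
  then show "summable (\<lambda>n. \<bar>x n + y n\<bar>)"
    by (rule summable_comparison_test'[where N = 0]) simp
qed

lift_definition minus_l1 :: "l1 \<Rightarrow> l1 \<Rightarrow> l1" is "\<lambda>x y n. x n - y n"
proof -
  fix x y :: "nat \<Rightarrow> real"
  assume "summable (\<lambda>n. \<bar>x n\<bar>)" and "summable (\<lambda>n. \<bar>y n\<bar>)"
  then have "summable (\<lambda>n. \<bar>x n\<bar> + \<bar>y n\<bar>)" by (rule summable_add)
  then show "summable (\<lambda>n. \<bar>x n - y n\<bar>)"
    by (rule summable_comparison_test'[where N = 0]) simp
qed

lift_definition uminus_l1 :: "l1 \<Rightarrow> l1" is "\<lambda>x n. - x n" by simp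

lift_definition scaleR_l1 :: "real \<Rightarrow> l1 \<Rightarrow> l1" is "\<lambda>a x n. a * x n"
  by (simp add: abs_mult summable_mult)

instance
  by standard (transfer; auto simp: algebra_simps)+

end

lemmas l1_nth_simps [simp] =
  zero_l1.rep_eq plus_l1.rep_eq minus_l1.rep_eq uminus_l1.rep_eq scaleR_l1.rep_eq

instantiation l1 :: real_normed_vector
begin

definition norm_l1 :: "l1 \<Rightarrow> real" where
  "norm_l1 x = (\<Sum>n. \<bar>l1_nth x n\<bar>)"

definition dist_l1 :: "l1 \<Rightarrow> l1 \<Rightarrow> real" where
  "dist_l1 x y = norm (x - y)"

definition sgn_l1 :: "l1 \<Rightarrow> l1" where
  "sgn_l1 x = x /\<^sub>R norm x"

definition uniformity_l1 :: "(l1 \<times> l1) filter" where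
  "uniformity_l1 = (INF e\<in>{0 <..}. principal {(x, y). dist x y < e})"

definition open_l1 :: "l1 set \<Rightarrow> bool" where
  "open_l1 S = (\<forall>x\<in>S. \<forall>\<^sub>F (x', y) in uniformity. x' = x \<longrightarrow> y \<in> S)"

instance
proof
  fix x y :: l1 and a :: real
  show "norm x = 0 \<longleftrightarrow> x = 0"
  proof
    assume "norm x = 0"
    then have "\<forall>n. \<bar>l1_nth x n\<bar> = 0"
      unfolding norm_l1_def by (subst (asm) suminf_eq_zero_iff) auto
    then show "x = 0" by (intro l1_eqI) simp
  qed (simp add: norm_l1_def)
  show "norm (x + y) \<le> norm x + norm y"
  proof -
    have "norm (x + y) \<le> (\<Sum>n. \<bar>l1_nth x n\<bar> + \<bar>l1_nth y n\<bar>)"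
      unfolding norm_l1_def
      using summable_l1_abs[of "x + y"] by (intro suminf_le summable_add) auto
    also have "\<dots> = norm x + norm y"
      unfolding norm_l1_def by (intro suminf_add[symmetric] summable_l1_abs)
    finally show ?thesis .
  qed
  show "norm (a *\<^sub>R x) = \<bar>a\<bar> * norm x"
    by (simp add: norm_l1_def abs_mult suminf_mult)
qed (simp_all add: dist_l1_def sgn_l1_def uniformity_l1_def open_l1_def)

end

lemma sum_abs_l1_le_norm: "(\<Sum>n<N. \<bar>l1_nth x n\<bar>) \<le> norm x"
  unfolding norm_l1_def by (rule sum_le_suminf) auto

lemma abs_l1_nth_le_norm: "\<bar>l1_nth x n\<bar> \<le> norm x"
proof -
  have "\<bar>l1_nth x n\<bar> \<le> (\<Sum>i<Suc n. \<bar>l1_nth x i\<bar>)"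
    by (rule member_le_sum) auto
  then show ?thesis using sum_abs_l1_le_norm[where x = x and N = "Suc n"] by linarith
qed

instance l1 :: banach
proof
  fix X :: "nat \<Rightarrow> l1"
  assume C: "Cauchy X"
  have "Cauchy (\<lambda>m. l1_nth (X m) n)" for n
  proof (rule metric_CauchyI)
    fix e :: real assume "e > 0"
    then obtain M where M: "\<forall>m\<ge>M. \<forall>k\<ge>M. norm (X m - X k) < e"
      using CauchyD[OF C] by blast
    have "dist (l1_nth (X m) n) (l1_nth (X k) n) \<le> norm (X m - X k)" for m k
      using abs_l1_nth_le_norm[of "X m - X k" n] by (simp add: dist_real_def)
    then show "\<exists>M. \<forall>m\<ge>M. \<forall>k\<ge>M. dist (l1_nth (X m) n) (l1_nth (X k) n) < e"
      using M by (meson order_le_less_trans)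
  qed
  then have "\<forall>n. \<exists>l. (\<lambda>m. l1_nth (X m) n) \<longlonglongrightarrow> l"
    using Cauchy_convergent convergent_def by blast
  then obtain g where g: "\<And>n. (\<lambda>m. l1_nth (X m) n) \<longlonglongrightarrow> g n" by metis
  have bound: "(\<Sum>n<N. \<bar>l1_nth (X m) n - g n\<bar>) \<le> e"
    if M: "\<forall>m\<ge>M. \<forall>k\<ge>M. norm (X m - X k) < e" and "m \<ge> M" for M m N e
  proof (rule LIMSEQ_le_const2)
    show "(\<lambda>k. \<Sum>n<N. \<bar>l1_nth (X m) n - l1_nth (X k) n\<bar>) \<longlonglongrightarrow> (\<Sum>n<N. \<bar>l1_nth (X m) n - g n\<bar>)"
      by (intro tendsto_intros g)
    have "(\<Sum>n<N. \<bar>l1_nth (X m) n - l1_nth (X k) n\<bar>) \<le> e" if "k \<ge> M" for k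
    proof -
      have "norm (X m - X k) < e" using M \<open>m \<ge> M\<close> that by blast
      then show ?thesis using sum_abs_l1_le_norm[where x = "X m - X k" and N = N] by simp
    qed
    then show "\<exists>M. \<forall>k\<ge>M. (\<Sum>n<N. \<bar>l1_nth (X m) n - l1_nth (X k) n\<bar>) \<le> e" by blast
  qed
  have summ: "summable (\<lambda>n. \<bar>l1_nth (X m) n - g n\<bar>)"
    if M: "\<forall>m\<ge>M. \<forall>k\<ge>M. norm (X m - X k) < e" and "m \<ge> M" for M m e
    by (rule summableI_nonneg_bounded[where x = e]) (use bound[OF that] in auto)
  obtain M1 where M1: "\<forall>m\<ge>M1. \<forall>k\<ge>M1. norm (X m - X k) < 1"
    using CauchyD[OF C, of 1] by auto
  have "summable (\<lambda>n. \<bar>l1_nth (X M1) n - g n\<bar> + \<bar>l1_nth (X M1) n\<bar>)"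
    by (intro summable_add summ[OF M1]) auto
  then have "summable (\<lambda>n. \<bar>g n\<bar>)"
    by (rule summable_comparison_test'[where N = 0]) auto
  then have nth_g: "l1_nth (Abs_l1 g) = g"
    by (simp add: Abs_l1_inverse)
  have "X \<longlonglongrightarrow> Abs_l1 g"
  proof (rule LIMSEQ_I)
    fix e :: real assume "e > 0"
    then obtain M where M: "\<forall>m\<ge>M. \<forall>k\<ge>M. norm (X m - X k) < e / 2"
      using CauchyD[OF C, of "e / 2"] by auto
    have "norm (X m - Abs_l1 g) \<le> e / 2" if "m \<ge> M" for m
      unfolding norm_l1_def
      by (rule suminf_le_const) (use bound[OF M that] summ[OF M that] in \<open>simp_all add: nth_g\<close>)
    then show "\<exists>M. \<forall>m\<ge>M. norm (X m - Abs_l1 g) < e"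
      using \<open>e > 0\<close> by (intro exI[of _ M]) fastforce
  qed
  then show "convergent X" by (rule convergentI)
qed

definition K1_plus :: "l1 set" where
  "K1_plus = {x. \<forall>n. 0 < l1_nth x n}"

section \<open>Bounded real sequences as the dual space\<close>

text \<open>As \<open>nat\<close> carries the discrete topology, bounded continuous functions on \<open>nat\<close> with the
  supremum norm are exactly the bounded sequences.\<close>

type_synonym linf = "nat \<Rightarrow>\<^sub>C real"

definition pairing :: "linf \<Rightarrow> l1 \<Rightarrow> real" where
  "pairing \<phi> x = (\<Sum>n. apply_bcontfun \<phi> n * l1_nth x n)"

text \<open>The identification of a bounded sequence with the functional it induces through the
  canonical pairing; \<open>linf_functional_apply\<close>, \<open>norm_linf_functional\<close> and
  \<open>bij_linf_functional\<close> below show that this is an isometric bijection onto the whole dual.\<close>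

definition linf_functional :: "linf \<Rightarrow> (l1 \<Rightarrow>\<^sub>L real)" where
  "linf_functional \<phi> = Blinfun (pairing \<phi>)"

definition beta :: "real \<Rightarrow> linf" where
  "beta d = const_bcontfun d"

lemma summable_abs_pairing: "summable (\<lambda>n. \<bar>apply_bcontfun \<phi> n * l1_nth x n\<bar>)"
proof (rule summable_comparison_test'[where N = 0])
  show "summable (\<lambda>n. norm \<phi> * \<bar>l1_nth x n\<bar>)" by (intro summable_mult) simp
  show "norm \<bar>apply_bcontfun \<phi> n * l1_nth x n\<bar> \<le> norm \<phi> * \<bar>l1_nth x n\<bar>" for n
    using norm_bounded[of \<phi> n] by (simp add: abs_mult mult_right_mono)
qed

lemma summable_pairing: "summable (\<lambda>n. apply_bcontfun \<phi> n * l1_nth x n)"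
  using summable_abs_pairing by (rule summable_rabs_cancel)

lemma abs_pairing_le: "\<bar>pairing \<phi> x\<bar> \<le> norm x * norm \<phi>"
proof -
  have "\<bar>pairing \<phi> x\<bar> \<le> (\<Sum>n. \<bar>apply_bcontfun \<phi> n * l1_nth x n\<bar>)"
    unfolding pairing_def by (rule summable_rabs[OF summable_abs_pairing])
  also have "\<dots> \<le> (\<Sum>n. norm \<phi> * \<bar>l1_nth x n\<bar>)"
    by (intro suminf_le summable_abs_pairing summable_mult summable_l1_abs)
      (use norm_bounded[of \<phi>] in \<open>simp add: abs_mult mult_right_mono\<close>)
  also have "\<dots> = norm x * norm \<phi>"
    by (simp add: norm_l1_def suminf_mult mult.commute)
  finally show ?thesis .
qed

lemma bounded_linear_pairing: "bounded_linear (pairing \<phi>)"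
proof (rule bounded_linear_intro)
  show "pairing \<phi> (x + y) = pairing \<phi> x + pairing \<phi> y" for x y
    by (simp add: pairing_def distrib_left suminf_add summable_pairing)
  show "pairing \<phi> (a *\<^sub>R x) = a *\<^sub>R pairing \<phi> x" for a x
    using suminf_mult[OF summable_pairing, of a \<phi> x] by (simp add: pairing_def mult.left_commute)
  show "norm (pairing \<phi> x) \<le> norm x * norm \<phi>" for x
    using abs_pairing_le by simp
qed

lemma linf_functional_apply: "blinfun_apply (linf_functional \<phi>) x = pairing \<phi> x"
  by (simp add: linf_functional_def bounded_linear_Blinfun_apply bounded_linear_pairing)

lift_definition l1_unit :: "nat \<Rightarrow> l1" is "\<lambda>k n. if n = k then 1 else 0"
proof -
  fix k :: nat
  show "summable (\<lambda>n. \<bar>if n = k then 1 else 0 :: real\<bar>)"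
    by (rule summable_finite[of "{k}"]) auto
qed

lemma norm_l1_unit: "norm (l1_unit k) = 1"
  unfolding norm_l1_def l1_unit.rep_eq
  by (subst suminf_finite[of "{k}"]) auto

lemma pairing_l1_unit: "pairing \<phi> (l1_unit k) = apply_bcontfun \<phi> k"
  unfolding pairing_def l1_unit.rep_eq
  by (subst suminf_finite[of "{k}"]) auto

lemma norm_linf_functional: "norm (linf_functional \<phi>) = norm \<phi>"
proof (rule antisym)
  show "norm (linf_functional \<phi>) \<le> norm \<phi>"
    by (rule norm_blinfun_bound)
      (use abs_pairing_le in \<open>simp_all add: linf_functional_apply mult.commute\<close>)
  show "norm \<phi> \<le> norm (linf_functional \<phi>)"
  proof (rule norm_bound)
    fix n
    show "norm (apply_bcontfun \<phi> n) \<le> norm (linf_functional \<phi>)"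
      using norm_blinfun[of "linf_functional \<phi>" "l1_unit n"]
      by (simp add: linf_functional_apply pairing_l1_unit norm_l1_unit)
  qed
qed

lemma l1_nth_sum: "l1_nth (sum f A) n = (\<Sum>i\<in>A. l1_nth (f i) n)"
  by (induction A rule: infinite_finite_induct) auto

lemma l1_unit_expansion: "(\<lambda>N. \<Sum>k<N. l1_nth x k *\<^sub>R l1_unit k) \<longlonglongrightarrow> x"
proof -
  define S where "S N = (\<Sum>k<N. l1_nth x k *\<^sub>R l1_unit k)" for N
  have S: "l1_nth (x - S N) n = (if n < N then 0 else l1_nth x n)" for N n
  proof -
    have "l1_nth (S N) n = (\<Sum>k<N. if n = k then l1_nth x k else 0)"
      unfolding S_def l1_nth_sum scaleR_l1.rep_eq l1_unit.rep_eq by (rule sum.cong) auto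
    then show ?thesis by (simp add: minus_l1.rep_eq)
  qed
  have "norm (S N - x) = norm x - (\<Sum>n<N. \<bar>l1_nth x n\<bar>)" for N
  proof -
    have "norm (S N - x) = (\<Sum>n. \<bar>l1_nth (x - S N) n\<bar>)"
      by (subst norm_minus_commute) (rule norm_l1_def)
    also have "\<dots> = (\<Sum>n. \<bar>l1_nth (x - S N) (n + N)\<bar>) + (\<Sum>n<N. \<bar>l1_nth (x - S N) n\<bar>)"
      by (rule suminf_split_initial_segment) (rule summable_l1_abs)
    also have "(\<Sum>n<N. \<bar>l1_nth (x - S N) n\<bar>) = 0"
      by (intro sum.neutral ballI) (simp only: S lessThan_iff if_True abs_zero)
    also have "(\<Sum>n. \<bar>l1_nth (x - S N) (n + N)\<bar>) = (\<Sum>n. \<bar>l1_nth x (n + N)\<bar>)"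
      by (simp only: S not_add_less2 if_False)
    also have "\<dots> = norm x - (\<Sum>n<N. \<bar>l1_nth x n\<bar>)"
      unfolding norm_l1_def by (rule suminf_minus_initial_segment) (rule summable_l1_abs)
    finally show ?thesis by (simp only: add_0_right)
  qed
  moreover have "(\<lambda>N. norm x - (\<Sum>n<N. \<bar>l1_nth x n\<bar>)) \<longlonglongrightarrow> norm x - norm x"
    unfolding norm_l1_def by (intro tendsto_diff tendsto_const summable_LIMSEQ summable_l1_abs)
  ultimately have "(\<lambda>N. norm (S N - x)) \<longlonglongrightarrow> 0"
    by (simp only: diff_self)
  then have "(\<lambda>N. S N - x) \<longlonglongrightarrow> 0"
    by (rule tendsto_norm_zero_cancel)
  then have "S \<longlonglongrightarrow> x"
    by (rule LIM_zero_cancel)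
  then show ?thesis unfolding S_def .
qed

lemma bij_linf_functional: "bij linf_functional"
proof (rule bijI)
  show "inj linf_functional"
  proof (rule injI)
    fix \<phi> \<psi> assume "linf_functional \<phi> = linf_functional \<psi>"
    then have "pairing \<phi> (l1_unit n) = pairing \<psi> (l1_unit n)" for n
      by (metis linf_functional_apply)
    then show "\<phi> = \<psi>" by (intro bcontfun_eqI) (simp add: pairing_l1_unit)
  qed
  have "\<exists>\<phi>. f = linf_functional \<phi>" for f :: "l1 \<Rightarrow>\<^sub>L real"
  proof -
    define u where "u n = blinfun_apply f (l1_unit n)" for n
    have "u \<in> bcontfun"
    proof (rule bcontfun_normI)
      show "norm (u n) \<le> norm f" for n
        using norm_blinfun[of f "l1_unit n"] by (simp add: u_def norm_l1_unit)
    qed simp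
    then obtain \<phi> where \<phi>: "u = apply_bcontfun \<phi>" by (rule bcontfunE)
    have "blinfun_apply f x = blinfun_apply (linf_functional \<phi>) x" for x
    proof (rule LIMSEQ_unique)
      show "(\<lambda>N. blinfun_apply f (\<Sum>k<N. l1_nth x k *\<^sub>R l1_unit k)) \<longlonglongrightarrow> blinfun_apply f x"
        by (intro tendsto_intros l1_unit_expansion)
      have "(\<lambda>N. blinfun_apply (linf_functional \<phi>) (\<Sum>k<N. l1_nth x k *\<^sub>R l1_unit k))
              \<longlonglongrightarrow> blinfun_apply (linf_functional \<phi>) x"
        by (intro tendsto_intros l1_unit_expansion)
      then show "(\<lambda>N. blinfun_apply f (\<Sum>k<N. l1_nth x k *\<^sub>R l1_unit k))
              \<longlonglongrightarrow> blinfun_apply (linf_functional \<phi>) x"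
        by (simp add: blinfun.sum_right blinfun.scaleR_right linf_functional_apply pairing_l1_unit
            u_def flip: \<phi>)
    qed
    then show ?thesis by (intro exI[of _ \<phi>] blinfun_eqI)
  qed
  then show "surj linf_functional" by (auto simp: surj_def)
qed

text \<open>On the positive cone the duality mapping is single-valued, so that \<open>the_elem\<close> extracts
  its value there.\<close>

lemma duality_mapping_K1_plus:
  assumes "x \<in> K1_plus"
  shows "duality_mapping x = {linf_functional (beta (norm x))}"
proof -
  have pos: "l1_nth x n > 0" for n using assms by (simp add: K1_plus_def)
  have sx: "summable (l1_nth x)" using summable_l1_abs[of x] by (rule summable_rabs_cancel)
  have "\<bar>l1_nth x n\<bar> = l1_nth x n" for n using pos[of n] by simp
  then have nx: "norm x = (\<Sum>n. l1_nth x n)"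
    by (simp only: norm_l1_def)
  have nb: "norm (beta (norm x)) = norm x"
  proof (rule antisym)
    show "norm (beta (norm x)) \<le> norm x" by (rule norm_bound) (simp add: beta_def)
    show "norm x \<le> norm (beta (norm x))"
      using norm_bounded[of "beta (norm x)" 0] by (simp add: beta_def)
  qed
  have sq: "(\<Sum>n. norm x * l1_nth x n) = (norm x)\<^sup>2"
    unfolding suminf_mult[OF sx] nx[symmetric] by (rule power2_eq_square[symmetric])
  then have "pairing (beta (norm x)) x = (norm x)\<^sup>2"
    by (simp add: pairing_def beta_def)
  then have mem: "linf_functional (beta (norm x)) \<in> duality_mapping x"
    by (simp add: duality_mapping_def norm_linf_functional nb linf_functional_apply
        power2_eq_square)
  have "f = linf_functional (beta (norm x))" if f: "f \<in> duality_mapping x" for f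
  proof -
    obtain \<phi> where \<phi>: "f = linf_functional \<phi>"
      using bij_linf_functional by (metis bij_pointE)
    have n: "norm \<phi> = norm x"
      using f by (simp add: duality_mapping_def \<phi> norm_linf_functional)
    have p: "(\<Sum>n. apply_bcontfun \<phi> n * l1_nth x n) = (norm x)\<^sup>2"
      using f unfolding duality_mapping_def \<phi> mem_Collect_eq linf_functional_apply pairing_def
      by linarith
    have s1: "summable (\<lambda>n. norm x * l1_nth x n)" by (intro summable_mult sx)
    have "(\<Sum>n. norm x * l1_nth x n - apply_bcontfun \<phi> n * l1_nth x n) = 0"
      unfolding suminf_diff[OF s1 summable_pairing[of \<phi> x], symmetric] sq p by (rule diff_self)
    moreover have "0 \<le> norm x * l1_nth x n - apply_bcontfun \<phi> n * l1_nth x n" for n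
      using norm_bounded[of \<phi> n] pos[of n] n by (simp add: mult_right_mono)
    ultimately have "\<forall>n. norm x * l1_nth x n - apply_bcontfun \<phi> n * l1_nth x n = 0"
      using suminf_eq_zero_iff[OF summable_diff[OF s1 summable_pairing]] by blast
    then have "apply_bcontfun \<phi> n = norm x" for n
      using pos[of n] by (auto simp: left_diff_distrib[symmetric] dest!: spec[of _ n])
    then have "\<phi> = beta (norm x)" by (intro bcontfun_eqI) (simp add: beta_def)
    then show ?thesis by (simp add: \<phi>)
  qed
  with mem show ?thesis by blast
qed

end

theory Submission
  imports Defs
begin

text \<open>
  A functional \<open>x'\<close> lies in the derivative iff \<open>x' (u - x) - y' (v - y)\<close> is at most
  \<open>o (norm (u - x) + norm (v - y))\<close> along the graph of the projection. So an element of the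
  derivative is constrained by every curve and every sequence in the graph that tends to the base
  point, and all that matters is to choose good ones.

  Outside the ball the radial retraction \<open>u \<mapsto> (r / norm u) *\<^sub>R u\<close> is a Lipschitz selection of
  the projection, inside the ball the identity is the only one. Following these selections along
  a ray \<open>x + t *\<^sub>R h\<close> gives \<open>x' h \<le> c\<close>, where \<open>c\<close> is the rate at which \<open>y'\<close> changes along the
  selection (\<open>mordukhovich_derivative_ray_le\<close>). Inside the ball \<open>c = y' h\<close>, and replacing
  \<open>h\<close> by \<open>- h\<close> yields \<open>x' = y'\<close>. Outside the ball with \<open>y' = 0\<close> we have \<open>c = 0\<close>, and the same
  reversal yields \<open>x' = 0\<close>.

  For \<open>y' = beta d\<close> there are two competing constraints. The functional \<open>beta d\<close> coincides with
  \<open>d\<close> times the norm on the positive cone, so it is constant along radial projections that stay in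
  the cone. A positive sequence stays positive under small changes of one coordinate, hence
  \<open>x'\<close> must vanish on all unit vectors, and \<open>x' = 0\<close>. But the cone has empty interior: flipping the
  sign of the \<open>k\<close>-th coordinate of \<open>x\<close> gives points that converge to \<open>x\<close> as \<open>k\<close> grows, since the
  coordinates tend to \<open>0\<close>. Their radial projections lose \<open>beta d\<close> at a rate proportional to the
  displacement, which rules out \<open>x' = 0\<close> when \<open>d > 0\<close>. On the positive cone the value of
  the duality mapping at \<open>x\<close> is the functional \<open>beta (norm x)\<close>, so it falls under this case.
\<close>

section \<open>The derivative along curves in the graph\<close>

lemma mem_mordukhovich_derivative_iff:
  "x' \<in> mordukhovich_derivative P x y y' \<longleftrightarrow>
    (\<forall>e>0. \<forall>\<^sub>F (u, v) in at (x, y) within {(u, v). v \<in> P u}.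
       blinfun_apply x' (u - x) - blinfun_apply y' (v - y) < e * (norm (u - x) + norm (v - y)))"
proof -
  let ?F = "at (x, y) within {(u, v). v \<in> P u}"
  let ?N = "\<lambda>u v. blinfun_apply x' (u - x) - blinfun_apply y' (v - y)"
  let ?D = "\<lambda>u v. norm (u - x) + norm (v - y)"
  have ne: "\<forall>\<^sub>F p in ?F. p \<noteq> (x, y)"
    by (auto simp: eventually_at_filter)
  have quot: "?N u v / ?D u v < e \<longleftrightarrow> ?N u v < e * ?D u v" if "(u, v) \<noteq> (x, y)" for u v e
  proof -
    have "?D u v > 0"
      using that by (auto simp: add_pos_nonneg add_nonneg_pos)
    then show ?thesis by (simp add: divide_less_eq)
  qed
  have ev: "(\<forall>\<^sub>F p in ?F. (case p of (u, v) \<Rightarrow> ereal (?N u v / ?D u v)) < ereal e) \<longleftrightarrow>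
        (\<forall>\<^sub>F (u, v) in ?F. ?N u v < e * ?D u v)" for e
    by (rule eventually_cong[OF ne]) (auto simp: quot)
  have "x' \<in> mordukhovich_derivative P x y y' \<longleftrightarrow>
      (\<forall>c>0. \<forall>\<^sub>F p in ?F. (case p of (u, v) \<Rightarrow> ereal (?N u v / ?D u v)) < c)"
    by (simp add: mordukhovich_derivative_def Limsup_le_iff)
  also have "\<dots> \<longleftrightarrow> (\<forall>e>0. \<forall>\<^sub>F p in ?F. (case p of (u, v) \<Rightarrow> ereal (?N u v / ?D u v)) < ereal e)"
    (is "?L \<longleftrightarrow> ?R")
  proof
    assume R: ?R
    show ?L
    proof (intro allI impI)
      fix c :: ereal assume "c > 0"
      then obtain e where e: "0 < ereal e" "ereal e < c"
        using ereal_dense2 by blast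
      then have "\<forall>\<^sub>F p in ?F. (case p of (u, v) \<Rightarrow> ereal (?N u v / ?D u v)) < ereal e"
        using R by simp
      then show "\<forall>\<^sub>F p in ?F. (case p of (u, v) \<Rightarrow> ereal (?N u v / ?D u v)) < c"
        by eventually_elim (rule less_trans[OF _ e(2)])
    qed
  qed auto
  finally show ?thesis by (simp only: ev)
qed

lemma mordukhovich_derivative_along_curve:
  assumes mem: "x' \<in> mordukhovich_derivative P x y y'"
    and U: "(U \<longlongrightarrow> x) F" and V: "(V \<longlongrightarrow> y) F"
    and graph: "\<forall>\<^sub>F i in F. V i \<in> P (U i)" and ne: "\<forall>\<^sub>F i in F. U i \<noteq> x" and "e > 0"
  shows "\<forall>\<^sub>F i in F. blinfun_apply x' (U i - x) - blinfun_apply y' (V i - y)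
           < e * (norm (U i - x) + norm (V i - y))"
proof -
  have "filterlim (\<lambda>i. (U i, V i)) (at (x, y) within {(u, v). v \<in> P u}) F"
    unfolding filterlim_at
    using tendsto_Pair[OF U V] eventually_conj[OF graph ne]
    by (auto elim: eventually_mono)
  moreover have "\<forall>\<^sub>F (u, v) in at (x, y) within {(u, v). v \<in> P u}.
       blinfun_apply x' (u - x) - blinfun_apply y' (v - y) < e * (norm (u - x) + norm (v - y))"
    using mem \<open>e > 0\<close> by (simp add: mem_mordukhovich_derivative_iff)
  ultimately show ?thesis
    by (auto dest: filterlim_iff[THEN iffD1, rule_format] elim: eventually_mono)
qed

text \<open>The Lipschitz bound on the selection \<open>V\<close> makes the error term \<open>o (t)\<close>, so dividing by \<open>t\<close>
  and letting \<open>t\<close> tend to \<open>0\<close> leaves a clean inequality.\<close>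

lemma mordukhovich_derivative_ray_le:
  assumes mem: "x' \<in> mordukhovich_derivative P x y y'" and "C \<ge> 0"
    and graph: "\<forall>\<^sub>F t in at_right 0. V t \<in> P (x + t *\<^sub>R h)"
    and lip: "\<forall>\<^sub>F t in at_right 0. norm (V t - y) \<le> C * norm (t *\<^sub>R h)"
    and rate: "\<forall>\<^sub>F t in at_right 0. blinfun_apply y' (V t - y) = t * c"
  shows "blinfun_apply x' h \<le> c"
proof (cases "h = 0")
  case True
  have "\<forall>\<^sub>F t in at_right (0::real). t * c = 0"
    using lip rate by eventually_elim (simp add: True)
  moreover have "\<forall>\<^sub>F t in at_right (0::real). t > 0"
    by (rule eventually_at_right_less)
  ultimately have "\<forall>\<^sub>F t in at_right (0::real). c = 0"
    by eventually_elim auto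
  then show ?thesis by (simp add: True)
next
  case False
  have pos: "\<forall>\<^sub>F t in at_right (0::real). t > 0"
    by (rule eventually_at_right_less)
  have U: "((\<lambda>t. x + t *\<^sub>R h) \<longlongrightarrow> x) (at_right 0)"
    by (auto intro!: tendsto_eq_intros)
  have "((\<lambda>t. V t - y) \<longlongrightarrow> 0) (at_right 0)"
  proof (rule Lim_null_comparison[OF lip])
    show "((\<lambda>t. C * norm (t *\<^sub>R h)) \<longlongrightarrow> 0) (at_right 0)"
      by (auto intro!: tendsto_eq_intros)
  qed
  then have V: "(V \<longlongrightarrow> y) (at_right 0)"
    by (rule LIM_zero_cancel)
  have ne: "\<forall>\<^sub>F t in at_right 0. x + t *\<^sub>R h \<noteq> x"
    using pos by eventually_elim (use False in auto)
  have "blinfun_apply x' h \<le> c + e * ((1 + C) * norm h)" if "e > 0" for e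
  proof -
    have "\<forall>\<^sub>F t in at_right (0::real). blinfun_apply x' h \<le> c + e * ((1 + C) * norm h)"
      using mordukhovich_derivative_along_curve[OF mem U V graph ne \<open>e > 0\<close>] lip rate pos
    proof eventually_elim
      case (elim t)
      have "e * (norm (t *\<^sub>R h) + norm (V t - y)) \<le> e * (norm (t *\<^sub>R h) + C * norm (t *\<^sub>R h))"
        using elim(2) \<open>e > 0\<close> by simp
      then have "t * blinfun_apply x' h - t * c < e * (norm (t *\<^sub>R h) + C * norm (t *\<^sub>R h))"
        using elim(1,3) by (simp add: blinfun.scaleR_right)
      then have "t * blinfun_apply x' h < t * (c + e * ((1 + C) * norm h))"
        using elim(4) by (simp add: algebra_simps)
      then show ?case using elim(4) by simp
    qed
    then show ?thesis by simp
  qed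
  then have lim: "\<forall>\<^sub>F e in at_right 0. blinfun_apply x' h \<le> c + e * ((1 + C) * norm h)"
    by (auto simp: eventually_at_filter)
  have "((\<lambda>e. c + e * ((1 + C) * norm h)) \<longlongrightarrow> c) (at_right 0)"
    by (auto intro!: tendsto_eq_intros)
  from tendsto_lowerbound[OF this lim] show ?thesis by simp
qed

text \<open>Since \<open>h\<close> and \<open>- h\<close> are both available, one-sided bounds suffice to identify a functional.\<close>

lemma blinfun_eqI_le:
  fixes f g :: "'a::real_normed_vector \<Rightarrow>\<^sub>L real"
  assumes "\<And>h. blinfun_apply f h \<le> blinfun_apply g h"
  shows "f = g"
proof (rule blinfun_eqI)
  fix h
  show "blinfun_apply f h = blinfun_apply g h"
    using assms[of h] assms[of "- h"] by (simp add: blinfun.minus_right)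
qed

section \<open>Projecting onto a ball\<close>

lemma metric_projection_self:
  assumes "u \<in> C"
  shows "metric_projection C u = {u}"
  using assms by (auto simp: metric_projection_def)

lemma radial_mem_metric_projection:
  fixes u :: "'a::banach"
  assumes "0 < r" "r < norm u"
  shows "(r / norm u) *\<^sub>R u \<in> metric_projection (cball 0 r) u"
proof -
  have "u - (r / norm u) *\<^sub>R u = (1 - r / norm u) *\<^sub>R u"
    by (simp add: scaleR_left_diff_distrib)
  then have "norm (u - (r / norm u) *\<^sub>R u) = \<bar>1 - r / norm u\<bar> * norm u"
    by simp
  also have "\<bar>1 - r / norm u\<bar> = 1 - r / norm u"
    using assms by (simp add: divide_le_eq)
  also have "(1 - r / norm u) * norm u = norm u - r"
    using assms by (auto simp: left_diff_distrib)
  finally have "norm (u - (r / norm u) *\<^sub>R u) = norm u - r" .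
  moreover have "norm u - r \<le> norm (u - z)" if "norm z \<le> r" for z
    using that norm_triangle_ineq2[of u z] by linarith
  ultimately show ?thesis
    using assms by (simp add: metric_projection_def)
qed

lemma radial_lipschitz:
  fixes u x :: "'a::real_normed_vector"
  assumes "0 < r" "r < norm u" "r < norm x"
  shows "norm ((r / norm u) *\<^sub>R u - (r / norm x) *\<^sub>R x) \<le> 2 * norm (u - x)"
proof -
  have nz: "norm u > 0" "norm x > 0" using assms by linarith+
  have "(r / norm u) *\<^sub>R u - (r / norm x) *\<^sub>R x
      = (r / norm u) *\<^sub>R (u - x) + (r / norm u - r / norm x) *\<^sub>R x"
    by (simp add: algebra_simps)
  then have "norm ((r / norm u) *\<^sub>R u - (r / norm x) *\<^sub>R x)
      \<le> norm ((r / norm u) *\<^sub>R (u - x)) + norm ((r / norm u - r / norm x) *\<^sub>R x)"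
    by (simp only: norm_triangle_ineq)
  also have "norm ((r / norm u) *\<^sub>R (u - x)) = r / norm u * norm (u - x)"
    using assms by simp
  also have "norm ((r / norm u - r / norm x) *\<^sub>R x) = \<bar>(r / norm u - r / norm x) * norm x\<bar>"
    by (simp add: abs_mult)
  also have "(r / norm u - r / norm x) * norm x = r / norm u * (norm x - norm u)"
    using nz by (simp add: field_simps)
  also have "\<bar>r / norm u * (norm x - norm u)\<bar> = r / norm u * \<bar>norm x - norm u\<bar>"
    using assms by (simp add: abs_mult)
  also have "r / norm u * norm (u - x) + r / norm u * \<bar>norm x - norm u\<bar>
      = r / norm u * (norm (u - x) + \<bar>norm x - norm u\<bar>)"
    by (simp only: distrib_left)
  also have "\<dots> \<le> r / norm u * (norm (u - x) + norm (u - x))"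
    using assms norm_triangle_ineq3[of x u]
    by (intro mult_left_mono) (auto simp: norm_minus_commute)
  finally have "norm ((r / norm u) *\<^sub>R u - (r / norm x) *\<^sub>R x)
      \<le> r / norm u * (norm (u - x) + norm (u - x))" .
  also have "\<dots> \<le> 1 * (norm (u - x) + norm (u - x))"
    using assms by (intro mult_right_mono) (auto simp: divide_le_eq)
  finally show ?thesis by simp
qed

lemma eventually_ray_norm_greater:
  fixes x h :: "'a::real_normed_vector"
  assumes "r < norm x"
  shows "\<forall>\<^sub>F t in at_right 0. r < norm (x + t *\<^sub>R h)"
proof -
  have "((\<lambda>t. norm (x + t *\<^sub>R h)) \<longlongrightarrow> norm x) (at_right 0)"
    by (auto intro!: tendsto_eq_intros)
  then show ?thesis using assms by (rule order_tendstoD)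
qed

lemma mordukhovich_derivative_ball_interior:
  fixes x :: "'a::banach"
  assumes x: "norm x < r"
  shows "mordukhovich_derivative (metric_projection (cball 0 r)) x x y' = {y'}"
proof (intro equalityI subsetI)
  fix x' assume mem: "x' \<in> mordukhovich_derivative (metric_projection (cball 0 r)) x x y'"
  have "blinfun_apply x' h \<le> blinfun_apply y' h" for h
  proof (rule mordukhovich_derivative_ray_le[OF mem, where C = 1 and V = "\<lambda>t. x + t *\<^sub>R h"])
    have "((\<lambda>t. norm (x + t *\<^sub>R h)) \<longlongrightarrow> norm x) (at_right 0)"
      by (auto intro!: tendsto_eq_intros)
    then have "\<forall>\<^sub>F t in at_right 0. norm (x + t *\<^sub>R h) < r"
      using x by (rule order_tendstoD)
    then show "\<forall>\<^sub>F t in at_right 0. x + t *\<^sub>R h \<in> metric_projection (cball 0 r) (x + t *\<^sub>R h)"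
      by eventually_elim (simp add: metric_projection_self)
  qed (simp_all add: blinfun.scaleR_right)
  then show "x' \<in> {y'}" by (simp add: blinfun_eqI_le)
next
  fix x' assume "x' \<in> {y'}"
  moreover have "y' \<in> mordukhovich_derivative (metric_projection (cball 0 r)) x x y'"
    unfolding mem_mordukhovich_derivative_iff
  proof (intro allI impI)
    fix e :: real assume "e > 0"
    \<comment> \<open>On this neighbourhood the graph is the diagonal, where the numerator vanishes.\<close>
    have "open (ball (0::'a) r \<times> (UNIV :: 'a set))"
      by (intro open_Times) auto
    moreover have "(x, x) \<in> ball 0 r \<times> UNIV" using x by simp
    ultimately show "\<forall>\<^sub>F (u, v) in at (x, x) within {(u, v). v \<in> metric_projection (cball 0 r) u}.
       blinfun_apply y' (u - x) - blinfun_apply y' (v - x) < e * (norm (u - x) + norm (v - x))"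
      unfolding eventually_at_topological
      using \<open>e > 0\<close>
      by (intro exI[of _ "ball 0 r \<times> UNIV"]) (auto simp: metric_projection_self)
  qed
  ultimately show "x' \<in> mordukhovich_derivative (metric_projection (cball 0 r)) x x y'" by simp
qed

text \<open>The radial retraction is the Lipschitz selection to follow outside the ball.\<close>

lemma mordukhovich_derivative_ball_exterior_le:
  fixes x :: "'a::banach"
  assumes r: "0 < r" "r < norm x"
    and mem: "x' \<in> mordukhovich_derivative (metric_projection (cball 0 r)) x ((r / norm x) *\<^sub>R x) y'"
    and rate: "\<forall>\<^sub>F t in at_right 0. blinfun_apply y'
        ((r / norm (x + t *\<^sub>R h)) *\<^sub>R (x + t *\<^sub>R h) - (r / norm x) *\<^sub>R x) = t * c"
  shows "blinfun_apply x' h \<le> c"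
proof (rule mordukhovich_derivative_ray_le[OF mem _ _ _ rate, where C = 2])
  note out = eventually_ray_norm_greater[OF r(2), of h]
  show "\<forall>\<^sub>F t in at_right 0. (r / norm (x + t *\<^sub>R h)) *\<^sub>R (x + t *\<^sub>R h)
      \<in> metric_projection (cball 0 r) (x + t *\<^sub>R h)"
    using out by eventually_elim (rule radial_mem_metric_projection[OF r(1)])
  show "\<forall>\<^sub>F t in at_right 0. norm ((r / norm (x + t *\<^sub>R h)) *\<^sub>R (x + t *\<^sub>R h) - (r / norm x) *\<^sub>R x)
      \<le> 2 * norm (t *\<^sub>R h)"
    using out
  proof eventually_elim
    case (elim t)
    show ?case using radial_lipschitz[OF r(1) elim r(2)] by simp
  qed
qed simp

lemma mordukhovich_derivative_ball_exterior_zero: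
  fixes x :: "'a::banach"
  assumes r: "0 < r" "r < norm x"
  shows "mordukhovich_derivative (metric_projection (cball 0 r)) x ((r / norm x) *\<^sub>R x) 0 = {0}"
proof (intro equalityI subsetI)
  fix x'
  assume mem: "x' \<in> mordukhovich_derivative (metric_projection (cball 0 r)) x ((r / norm x) *\<^sub>R x) 0"
  have "blinfun_apply x' h \<le> blinfun_apply 0 h" for h
    using mordukhovich_derivative_ball_exterior_le[OF r mem, of h 0] by simp
  then show "x' \<in> {0}" by (simp add: blinfun_eqI_le)
next
  fix x' :: "'a \<Rightarrow>\<^sub>L real" assume "x' \<in> {0}"
  then show "x' \<in> mordukhovich_derivative (metric_projection (cball 0 r)) x ((r / norm x) *\<^sub>R x) 0"
    by (auto simp: mordukhovich_derivative_def case_prod_beta intro: Limsup_bounded)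
qed

section \<open>Constant functionals on the positive cone\<close>

lemma pairing_beta_K1_plus:
  assumes "w \<in> K1_plus"
  shows "pairing (beta d) w = d * norm w"
proof -
  have "\<bar>l1_nth w n\<bar> = l1_nth w n" for n
    using assms by (simp add: K1_plus_def less_imp_le)
  then have nw: "norm w = (\<Sum>n. l1_nth w n)" by (simp only: norm_l1_def)
  have "summable (l1_nth w)" using summable_l1_abs by (rule summable_rabs_cancel)
  then show ?thesis by (simp add: pairing_def beta_def nw suminf_mult)
qed

lemma K1_plus_scaleR:
  assumes "w \<in> K1_plus" "a > 0"
  shows "a *\<^sub>R w \<in> K1_plus"
  using assms by (simp add: K1_plus_def)

text \<open>Only finitely many coordinates move, which is what keeps the sequence positive: in a general
  direction \<open>h\<close> the ray may leave the cone at once.\<close>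

lemma eventually_unit_ray_in_K1_plus:
  assumes "x \<in> K1_plus"
  shows "\<forall>\<^sub>F t in at_right 0. x + t *\<^sub>R (s *\<^sub>R l1_unit k) \<in> K1_plus"
proof -
  have "((\<lambda>t. l1_nth x k + t * s) \<longlongrightarrow> l1_nth x k) (at_right 0)"
    by (auto intro!: tendsto_eq_intros)
  moreover have "0 < l1_nth x k" using assms by (simp add: K1_plus_def)
  ultimately have "\<forall>\<^sub>F t in at_right 0. 0 < l1_nth x k + t * s"
    by (rule order_tendstoD)
  then show ?thesis
    by eventually_elim (use assms in \<open>auto simp: K1_plus_def l1_unit.rep_eq\<close>)
qed

lemma blinfun_l1_eq_0I:
  fixes f :: "l1 \<Rightarrow>\<^sub>L real"
  assumes "\<And>k. blinfun_apply f (l1_unit k) = 0"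
  shows "f = 0"
proof -
  obtain \<phi> where \<phi>: "f = linf_functional \<phi>"
    using bij_linf_functional by (metis bij_pointE)
  have "apply_bcontfun \<phi> n = 0" for n
    using assms[of n] by (simp add: \<phi> linf_functional_apply pairing_l1_unit)
  then show ?thesis
    by (intro blinfun_eqI) (simp add: \<phi> linf_functional_apply pairing_def)
qed

lemma l1_nth_tendsto_0: "(\<lambda>k. l1_nth x k) \<longlonglongrightarrow> 0"
  using summable_LIMSEQ_zero[OF summable_l1_abs[of x]] by (simp add: tendsto_rabs_zero_iff)

lemma norm_flip_coordinate: "norm (x - (2 * l1_nth x k) *\<^sub>R l1_unit k) = norm x"
proof -
  have "\<bar>l1_nth (x - (2 * l1_nth x k) *\<^sub>R l1_unit k) n\<bar> = \<bar>l1_nth x n\<bar>" for n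
    by (simp add: l1_unit.rep_eq)
  then show ?thesis by (simp only: norm_l1_def)
qed

lemma mordukhovich_derivative_ball_beta_subset:
  assumes x: "x \<in> K1_plus" and r: "0 < r" "r < norm x"
  shows "mordukhovich_derivative (metric_projection (cball 0 r)) x ((r / norm x) *\<^sub>R x)
           (linf_functional (beta d)) \<subseteq> {0}"
proof
  fix x'
  assume mem: "x' \<in> mordukhovich_derivative (metric_projection (cball 0 r)) x ((r / norm x) *\<^sub>R x)
           (linf_functional (beta d))"
  have radial: "pairing (beta d) ((r / norm w) *\<^sub>R w) = d * r"
    if "w \<in> K1_plus" "r < norm w" for w
  proof -
    have "norm ((r / norm w) *\<^sub>R w) = r" using that r(1) by auto
    moreover have "(r / norm w) *\<^sub>R w \<in> K1_plus"
      using that r(1) less_trans[OF r(1) that(2)]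
    by (intro K1_plus_scaleR divide_pos_pos) simp_all
    ultimately show ?thesis by (simp only: pairing_beta_K1_plus)
  qed
  have le: "blinfun_apply x' (s *\<^sub>R l1_unit k) \<le> 0" for s k
  proof (rule mordukhovich_derivative_ball_exterior_le[OF r mem])
    show "\<forall>\<^sub>F t in at_right 0. blinfun_apply (linf_functional (beta d))
        ((r / norm (x + t *\<^sub>R (s *\<^sub>R l1_unit k))) *\<^sub>R (x + t *\<^sub>R (s *\<^sub>R l1_unit k))
          - (r / norm x) *\<^sub>R x) = t * 0"
      using eventually_unit_ray_in_K1_plus[OF x, of s k]
        eventually_ray_norm_greater[OF r(2), of "s *\<^sub>R l1_unit k"]
    proof eventually_elim
      case (elim t)
      show ?case
        unfolding blinfun.diff_right linf_functional_apply radial[OF elim] radial[OF x r(2)]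
        by simp
    qed
  qed
  have "blinfun_apply x' (l1_unit k) = 0" for k
    using le[of 1 k] le[of "- 1" k] by (simp add: blinfun.minus_right)
  then show "x' \<in> {0}" by (simp add: blinfun_l1_eq_0I)
qed

text \<open>Flipping the sign of the \<open>k\<close>-th coordinate keeps the norm, so the radial projection moves from
  \<open>a *\<^sub>R x\<close> by exactly \<open>a\<close> times the flip, where \<open>a = r / norm x\<close>. The quotient is then
  \<open>a * d / (1 + a)\<close> for every \<open>k\<close>.\<close>

lemma zero_notin_mordukhovich_derivative_ball_beta:
  assumes x: "x \<in> K1_plus" and r: "0 < r" "r < norm x" and d: "d > 0"
  shows "0 \<notin> mordukhovich_derivative (metric_projection (cball 0 r)) x ((r / norm x) *\<^sub>R x)
           (linf_functional (beta d))"
proof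
  assume mem: "0 \<in> mordukhovich_derivative (metric_projection (cball 0 r)) x ((r / norm x) *\<^sub>R x)
           (linf_functional (beta d))"
  define a where "a = r / norm x"
  define D where "D k = (2 * l1_nth x k) *\<^sub>R l1_unit k" for k
  have a: "a > 0" using r by (auto simp: a_def intro!: divide_pos_pos)
  have xk: "l1_nth x k > 0" for k using x by (simp add: K1_plus_def)
  have normD: "norm (D k) = 2 * l1_nth x k" for k
    using xk[of k] by (simp add: D_def norm_l1_unit)
  have "(\<lambda>k. norm (D k)) \<longlonglongrightarrow> 0"
    unfolding normD using tendsto_mult_right_zero[OF l1_nth_tendsto_0] .
  then have D0: "D \<longlonglongrightarrow> 0" by (rule tendsto_norm_zero_cancel)
  have U: "(\<lambda>k. x - D k) \<longlonglongrightarrow> x"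
    using tendsto_diff[OF tendsto_const D0, of x] by simp
  have V: "(\<lambda>k. a *\<^sub>R (x - D k)) \<longlonglongrightarrow> a *\<^sub>R x"
    by (rule tendsto_scaleR[OF tendsto_const U])
  have flip: "norm (x - D k) = norm x" for k
    unfolding D_def by (rule norm_flip_coordinate)
  have graph: "a *\<^sub>R (x - D k) \<in> metric_projection (cball 0 r) (x - D k)" for k
    using radial_mem_metric_projection[of r "x - D k"] r unfolding flip a_def by simp
  have ne: "x - D k \<noteq> x" for k
    using normD[of k] xk[of k] by auto
  define e where "e = a * d / (1 + a)"
  have e: "e > 0" using a d by (simp add: e_def)
  have "\<forall>\<^sub>F k in sequentially. blinfun_apply 0 (x - D k - x)
        - blinfun_apply (linf_functional (beta d)) (a *\<^sub>R (x - D k) - a *\<^sub>R x)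
      < e * (norm (x - D k - x) + norm (a *\<^sub>R (x - D k) - a *\<^sub>R x))"
    by (rule mordukhovich_derivative_along_curve[OF mem[folded a_def] U V _ _ e])
      (simp_all add: graph ne)
  then obtain k where k: "blinfun_apply 0 (x - D k - x)
        - blinfun_apply (linf_functional (beta d)) (a *\<^sub>R (x - D k) - a *\<^sub>R x)
      < e * (norm (x - D k - x) + norm (a *\<^sub>R (x - D k) - a *\<^sub>R x))"
    using eventually_happens by fastforce
  have dV: "a *\<^sub>R (x - D k) - a *\<^sub>R x = - (a *\<^sub>R D k)"
    by (simp add: scaleR_right_diff_distrib)
  have "blinfun_apply (linf_functional (beta d)) (D k) = d * norm (D k)"
    unfolding normD
    by (simp add: D_def blinfun.scaleR_right linf_functional_apply pairing_l1_unit beta_def)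
  then have "a * d * norm (D k) < e * (norm (D k) + a * norm (D k))"
    using k a unfolding dV by (simp add: blinfun.minus_right blinfun.scaleR_right)
  also have "\<dots> = e * (1 + a) * norm (D k)" by (simp add: algebra_simps)
  also have "e * (1 + a) = a * d" using a by (simp add: e_def)
  finally show False by simp
qed

lemma mordukhovich_derivative_ball_beta_empty:
  assumes "x \<in> K1_plus" "0 < r" "r < norm x" "d > 0"
  shows "mordukhovich_derivative (metric_projection (cball 0 r)) x ((r / norm x) *\<^sub>R x)
           (linf_functional (beta d)) = {}"
  using mordukhovich_derivative_ball_beta_subset[OF assms(1-3), of d]
    zero_notin_mordukhovich_derivative_ball_beta[OF assms] by blast

theorem theorem3p4:
  fixes r :: real
  assumes "r > 0"
  shows
    "(\<forall>x :: l1. norm x < r \<longrightarrow>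
       (\<forall>\<phi> :: linf.
          mordukhovich_derivative (metric_projection (cball 0 r)) x x (linf_functional \<phi>)
            = {linf_functional \<phi>})) \<and>
     (\<forall>x \<in> K1_plus. norm x > r \<longrightarrow>
       mordukhovich_derivative (metric_projection (cball 0 r)) x ((r / norm x) *\<^sub>R x) 0 = {0} \<and>
       (\<forall>d :: real. d > 0 \<longrightarrow>
          mordukhovich_derivative (metric_projection (cball 0 r)) x ((r / norm x) *\<^sub>R x)
            (linf_functional (beta d)) = {}) \<and>
       mordukhovich_derivative (metric_projection (cball 0 r)) x ((r / norm x) *\<^sub>R x)
         (the_elem (duality_mapping x)) = {})"
proof (intro conjI ballI allI impI)
  fix x :: l1 and \<phi> :: linf assume "norm x < r"
  then show "mordukhovich_derivative (metric_projection (cball 0 r)) x x (linf_functional \<phi>)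
      = {linf_functional \<phi>}"
    by (rule mordukhovich_derivative_ball_interior)
next
  fix x :: l1 assume x: "x \<in> K1_plus" "r < norm x"
  show "mordukhovich_derivative (metric_projection (cball 0 r)) x ((r / norm x) *\<^sub>R x) 0 = {0}"
    using assms x(2) by (rule mordukhovich_derivative_ball_exterior_zero)
  show "mordukhovich_derivative (metric_projection (cball 0 r)) x ((r / norm x) *\<^sub>R x)
      (linf_functional (beta d)) = {}" if "d > 0" for d
    using x(1) assms x(2) that by (rule mordukhovich_derivative_ball_beta_empty)
  from this[of "norm x"]
  show "mordukhovich_derivative (metric_projection (cball 0 r)) x ((r / norm x) *\<^sub>R x)
      (the_elem (duality_mapping x)) = {}"
    using x(2) less_trans[OF assms x(2)] by (simp add: duality_mapping_K1_plus[OF x(1)])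
qed

end
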